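(* Let $G_1$ be a finite graph with positive edge weights containing distinct vertices $u,v_1,v_2,v_3$ such that $u$ has degree $3$ with incident edges $uv_1$, $uv_2$, $uv_3$ of weights $c$, $b$, $d$ respectively, and containing an edge $v_1v_2$ of weight $a$. Let $G_2$ be obtained from $G_1$ by a $\lambda$-move, i.e. by deleting this edge $v_1v_2$ of weight $a$ and adding an edge $v_1v_3$ of weight $\frac{ad}{b}$, everything else being unchanged. Then $Z(G_1)=Z(G_2)$.
   Context: A dimer cover (perfect matching) of a finite graph $G$ is a set $M$ of edges such that each vertex is incident to exactly one edge of $M$. Given edge weights $\mathrm{wt}$, the dimer partition function is $Z(G)=\sum_{M}\prod_{e\in M}\mathrm{wt}(e)$, summed over all dimer covers $M$ of $G$. Multiple edges are allowed; the vertices $v_1,v_2,v_3$ may be connected arbitrarily to the rest of the graph (including additional edges among themselves). *)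

theory Defs
  imports Complex_Main
begin

(* Weighted multigraphs: edges have an identity of their own, so that distinct edges (possibly of
   different weights) may have the same pair of endpoints.  The values of ends and wt outside
   the edge set are irrelevant. *)
record ('v, 'e) wgraph =
  verts :: "'v set"
  edges :: "'e set"
  ends :: "'e \<Rightarrow> 'v set"
  wt :: "'e \<Rightarrow> real"

(* No loops: every edge has exactly two endpoints. *)
definition finite_graph :: "('v, 'e) wgraph \<Rightarrow> bool" where
  "finite_graph G \<longleftrightarrow> finite (verts G) \<and> finite (edges G) \<and>
     (\<forall>e\<in>edges G. ends G e \<subseteq> verts G \<and> card (ends G e) = 2)"

definition positive_weights :: "('v, 'e) wgraph \<Rightarrow> bool" where
  "positive_weights G \<longleftrightarrow> (\<forall>e\<in>edges G. wt G e > 0)"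

definition degree :: "('v, 'e) wgraph \<Rightarrow> 'v \<Rightarrow> nat" where
  "degree G v = card {e \<in> edges G. v \<in> ends G e}"

definition dimer_cover :: "('v, 'e) wgraph \<Rightarrow> 'e set \<Rightarrow> bool" where
  "dimer_cover G M \<longleftrightarrow> M \<subseteq> edges G \<and> (\<forall>v\<in>verts G. \<exists>!e. e \<in> M \<and> v \<in> ends G e)"

definition partition_function :: "('v, 'e) wgraph \<Rightarrow> real" where
  "partition_function G = (\<Sum>M | dimer_cover G M. \<Prod>e\<in>M. wt G e)"

definition delete_edge :: "'e \<Rightarrow> ('v, 'e) wgraph \<Rightarrow> ('v, 'e) wgraph" where
  "delete_edge e G = G\<lparr>edges := edges G - {e}\<rparr>"

(* Meant for a name f that is not yet an edge of G; otherwise the old edge f is overwritten. *)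
definition add_edge :: "'e \<Rightarrow> 'v \<Rightarrow> 'v \<Rightarrow> real \<Rightarrow> ('v, 'e) wgraph \<Rightarrow> ('v, 'e) wgraph" where
  "add_edge f x y w G =
     G\<lparr>edges := insert f (edges G), ends := (ends G)(f := {x, y}), wt := (wt G)(f := w)\<rparr>"

end

theory Submission
  imports Defs
begin

text \<open>
  Everything rests on the recursion for the partition function at an edge $e$: a dimer cover
  either avoids $e$, or consists of $e$ and a dimer cover of the graph from which both endpoints
  of $e$ have been removed, so $Z(G) = Z(G - e) + \mathrm{wt}(e)\, Z(G \setminus e)$
  (lemma \<open>partition_function_edge_recursion\<close>).

  Apply it in $G_1$ to the edge $v_1v_2$ of weight $a$. Once $v_1$ and $v_2$ are gone, the only
  edge left at $u$ is $uv_3$, so that edge is forced into every cover and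
  $Z(G_1) = Z(H) + a d\, Z(R)$, where $H$ is $G_1$ without $v_1v_2$ and $R$ is $G_1$ without the
  vertices $u, v_1, v_2, v_3$. In the same way the edge $v_1v_3$ of $G_2$ forces $uv_2$, so
  $Z(G_2) = Z(H) + \frac{ad}{b} b\, Z(R)$, with the same $H$ by construction, and with the same
  $R$ because both the deleted and the added edge disappear with the four vertices. The new weight
  is chosen precisely so that the two expressions agree. Lemma \<open>partition_function_forced_edge\<close>
  is the common form of the two computations.
\<close>

definition delete_verts :: "'v set \<Rightarrow> ('v, 'e) wgraph \<Rightarrow> ('v, 'e) wgraph" where
  "delete_verts S G =
     G\<lparr>verts := verts G - S, edges := {g \<in> edges G. ends G g \<inter> S = {}}\<rparr>"

lemma delete_verts_simps [simp]:
  "verts (delete_verts S G) = verts G - S"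
  "edges (delete_verts S G) = {g \<in> edges G. ends G g \<inter> S = {}}"
  "ends (delete_verts S G) = ends G"
  "wt (delete_verts S G) = wt G"
  by (simp_all add: delete_verts_def)

lemma delete_verts_delete_verts:
  "delete_verts T (delete_verts S G) = delete_verts (S \<union> T) G"
  by (auto simp: delete_verts_def intro!: wgraph.equality)

lemma delete_edge_simps [simp]:
  "verts (delete_edge e G) = verts G"
  "edges (delete_edge e G) = edges G - {e}"
  "ends (delete_edge e G) = ends G"
  "wt (delete_edge e G) = wt G"
  by (simp_all add: delete_edge_def)

lemma add_edge_simps [simp]:
  "verts (add_edge f x y w G) = verts G"
  "edges (add_edge f x y w G) = insert f (edges G)"
  "ends (add_edge f x y w G) = (ends G)(f := {x, y})"
  "wt (add_edge f x y w G) = (wt G)(f := w)"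
  by (simp_all add: add_edge_def)

lemma finite_graph_delete_verts: "finite_graph G \<Longrightarrow> finite_graph (delete_verts S G)"
  unfolding finite_graph_def by auto

text \<open>
  Needed because two graphs arising here may carry different junk values of \<^const>\<open>ends\<close> and
  \<^const>\<open>wt\<close> at names that are not edges, so they need not be equal as records.
\<close>
lemma partition_function_cong:
  assumes "verts G = verts H" and "edges G = edges H"
    and "\<And>g. g \<in> edges H \<Longrightarrow> ends G g = ends H g"
    and "\<And>g. g \<in> edges H \<Longrightarrow> wt G g = wt H g"
  shows "partition_function G = partition_function H"
proof -
  have "dimer_cover G M = dimer_cover H M" for M
  proof (cases "M \<subseteq> edges H")
    case True
    then have "g \<in> M \<and> v \<in> ends G g \<longleftrightarrow> g \<in> M \<and> v \<in> ends H g" for g v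
      using assms(3) by auto
    then show ?thesis
      by (simp add: dimer_cover_def assms(1,2))
  qed (simp add: dimer_cover_def assms(2))
  moreover have "(\<Prod>g\<in>M. wt G g) = (\<Prod>g\<in>M. wt H g)" if "dimer_cover H M" for M
    using that assms(4) by (intro prod.cong) (auto simp: dimer_cover_def)
  ultimately show ?thesis
    by (simp add: partition_function_def)
qed

lemma dimer_cover_unique:
  assumes "dimer_cover G M" "v \<in> verts G" "g \<in> M" "v \<in> ends G g" "h \<in> M" "v \<in> ends G h"
  shows "g = h"
  using assms unfolding dimer_cover_def by blast

lemma finite_dimer_covers: "finite_graph G \<Longrightarrow> finite {M. dimer_cover G M}"
  by (rule finite_subset[of _ "Pow (edges G)"]) (auto simp: finite_graph_def dimer_cover_def)

lemma dimer_cover_delete_edge_iff: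
  "dimer_cover (delete_edge e G) M \<longleftrightarrow> dimer_cover G M \<and> e \<notin> M"
  by (auto simp: dimer_cover_def)

text \<open>
  Removing the edge is a bijection between the covers that use it and the covers of what remains
  after removing its endpoints: no further edge of a cover can meet those endpoints.
\<close>
lemma dimer_cover_insert_iff:
  assumes G: "finite_graph G" and e: "e \<in> edges G" "e \<notin> N"
  shows "dimer_cover G (insert e N) \<longleftrightarrow> dimer_cover (delete_verts (ends G e) G) N"
proof
  assume M: "dimer_cover G (insert e N)"
  have sub: "ends G e \<subseteq> verts G"
    using G e(1) by (auto simp: finite_graph_def)
  have avoid: "ends G g \<inter> ends G e = {}" if "g \<in> N" for g
    using dimer_cover_unique[OF M] sub that e(2) by blast
  have "N \<subseteq> edges (delete_verts (ends G e) G)"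
    using M avoid by (auto simp: dimer_cover_def)
  moreover have "\<exists>!g. g \<in> N \<and> v \<in> ends G g" if "v \<in> verts G - ends G e" for v
  proof -
    have "\<exists>!g. g \<in> insert e N \<and> v \<in> ends G g"
      using M that by (auto simp: dimer_cover_def)
    with that show ?thesis
      by (metis DiffD2 insert_iff)
  qed
  ultimately show "dimer_cover (delete_verts (ends G e) G) N"
    by (simp add: dimer_cover_def)
next
  assume N: "dimer_cover (delete_verts (ends G e) G) N"
  have avoid: "g \<in> edges G \<and> ends G g \<inter> ends G e = {}" if "g \<in> N" for g
    using N that by (auto simp: dimer_cover_def)
  have "\<exists>!g. g \<in> insert e N \<and> v \<in> ends G g" if v: "v \<in> verts G" for v
  proof (cases "v \<in> ends G e")
    case True
    then show ?thesis using avoid by blast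
  next
    case False
    then have "\<exists>!g. g \<in> N \<and> v \<in> ends G g"
      using N v by (auto simp: dimer_cover_def)
    with False show ?thesis
      by (metis insert_iff)
  qed
  then show "dimer_cover G (insert e N)"
    using avoid e(1) by (auto simp: dimer_cover_def)
qed

lemma partition_function_edge_recursion:
  assumes G: "finite_graph G" and e: "e \<in> edges G"
  shows "partition_function G =
           partition_function (delete_edge e G)
             + wt G e * partition_function (delete_verts (ends G e) G)"
proof -
  let ?R = "delete_verts (ends G e) G"
  let ?w = "\<lambda>M. \<Prod>g\<in>M. wt G g"
  have "ends G e \<noteq> {}"
    using G e by (force simp: finite_graph_def)
  then have notin: "e \<notin> N" if "dimer_cover ?R N" for N
    using that by (auto simp: dimer_cover_def)
  have fin: "finite N" if "dimer_cover ?R N" for N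
    by (rule finite_subset[of _ "edges G"])
       (use that G in \<open>auto simp: dimer_cover_def finite_graph_def\<close>)
  have "partition_function G =
          sum ?w {M. dimer_cover G M \<and> e \<notin> M} + sum ?w {M. dimer_cover G M \<and> e \<in> M}"
    unfolding partition_function_def
    by (subst sum.union_disjoint[symmetric])
       (auto intro!: sum.cong finite_subset[OF _ finite_dimer_covers[OF G]])
  also have "sum ?w {M. dimer_cover G M \<and> e \<in> M} = (\<Sum>N | dimer_cover ?R N. ?w (insert e N))"
  proof (rule sum.reindex_bij_witness[of _ "insert e" "\<lambda>M. M - {e}"])
    fix M assume "M \<in> {M. dimer_cover G M \<and> e \<in> M}"
    then have "dimer_cover G M" "insert e (M - {e}) = M"
      by auto
    then show "M - {e} \<in> {N. dimer_cover ?R N}"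
      using dimer_cover_insert_iff[OF G e, of "M - {e}"] by simp
  next
    fix N assume "N \<in> {N. dimer_cover ?R N}"
    then show "insert e N \<in> {M. dimer_cover G M \<and> e \<in> M}"
      using dimer_cover_insert_iff[OF G e notin] by simp
  qed (auto simp: notin insert_absorb)
  also have "\<dots> = wt G e * partition_function ?R"
    by (simp add: partition_function_def sum_distrib_left fin notin)
  finally show ?thesis
    by (simp add: partition_function_def dimer_cover_delete_edge_iff)
qed

lemma partition_function_isolated_vertex:
  assumes "u \<in> verts G" and "\<And>g. g \<in> edges G \<Longrightarrow> u \<notin> ends G g"
  shows "partition_function G = 0"
proof -
  have "\<not> dimer_cover G M" for M
    using assms unfolding dimer_cover_def by blast
  then show ?thesis
    by (simp add: partition_function_def)
qed

lemma partition_function_pendant_edge: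
  assumes G: "finite_graph G" and r: "{g \<in> edges G. u \<in> ends G g} = {r}"
  shows "partition_function G = wt G r * partition_function (delete_verts (ends G r) G)"
proof -
  have "r \<in> edges G" "u \<in> ends G r"
    using r by auto
  then have "u \<in> verts G"
    using G by (auto simp: finite_graph_def)
  then have "partition_function (delete_edge r G) = 0"
    by (rule partition_function_isolated_vertex[of u "delete_edge r G", simplified]) (use r in auto)
  then show ?thesis
    using partition_function_edge_recursion[OF G \<open>r \<in> edges G\<close>] by simp
qed

text \<open>
  If choosing the edge $e$ blocks every edge at $u$ except $r$, then each cover that uses $e$
  must use $r$ as well, because $u$ has to be covered.
\<close>
lemma partition_function_forced_edge:
  assumes G: "finite_graph G" and e: "e \<in> edges G"
    and r: "{g \<in> edges G. ends G g \<inter> ends G e = {} \<and> u \<in> ends G g} = {r}"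
  shows "partition_function G =
           partition_function (delete_edge e G)
             + wt G e * wt G r * partition_function (delete_verts (ends G e \<union> ends G r) G)"
proof -
  have "partition_function (delete_verts (ends G e) G) =
          wt G r * partition_function (delete_verts (ends G e \<union> ends G r) G)"
    using partition_function_pendant_edge[OF finite_graph_delete_verts[OF G], of "ends G e" u r] r
    by (simp add: delete_verts_delete_verts)
  then show ?thesis
    using partition_function_edge_recursion[OF G e] by simp
qed

theorem lemma40:
  fixes G1 G2 :: "('v, 'e) wgraph"
    and u v1 v2 v3 :: 'v
    and e1 e2 e3 e f :: 'e
    and a b c d :: real
  assumes "finite_graph G1" and "positive_weights G1"
    and "{u, v1, v2, v3} \<subseteq> verts G1" and "distinct [u, v1, v2, v3]"
    and "degree G1 u = 3"
    and "e1 \<in> edges G1" and "ends G1 e1 = {u, v1}" and "wt G1 e1 = c"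
    and "e2 \<in> edges G1" and "ends G1 e2 = {u, v2}" and "wt G1 e2 = b"
    and "e3 \<in> edges G1" and "ends G1 e3 = {u, v3}" and "wt G1 e3 = d"
    and "e \<in> edges G1" and "ends G1 e = {v1, v2}" and "wt G1 e = a"
    and "f \<notin> edges (delete_edge e G1)"
    and "G2 = add_edge f v1 v3 (a * d / b) (delete_edge e G1)"
  shows "partition_function G1 = partition_function G2"
proof -
  note finite = assms(1) and positive = assms(2) and V = assms(3) and dist = assms(4)
    and e1 = assms(6,7) and e2 = assms(9-11) and e3 = assms(12-14) and e = assms(15-17)
    and f = assms(18) and G2 = assms(19)
  let ?S = "{u, v1, v2, v3}"
  have neq: "e1 \<noteq> e2" "e1 \<noteq> e3" "e2 \<noteq> e3"
    using e1(2) e2(2) e3(2) dist by (auto simp: doubleton_eq_iff)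
  have at_u: "{g \<in> edges G1. u \<in> ends G1 g} = {e1, e2, e3}"
  proof (rule card_subset_eq[symmetric])
    show "finite {g \<in> edges G1. u \<in> ends G1 g}"
      using finite by (simp add: finite_graph_def)
    show "card {e1, e2, e3} = card {g \<in> edges G1. u \<in> ends G1 g}"
      using assms(5) neq by (simp add: degree_def)
  qed (use e1 e2 e3 in auto)
  \<comment> \<open>The name of the new edge may be that of the deleted one, but not that of another edge.\<close>
  have f_neq: "g \<noteq> f" if "g \<in> edges G1" "g \<noteq> e" for g
    using f that by auto
  have not_e: "e1 \<noteq> e" "e2 \<noteq> e" "e3 \<noteq> e"
    using e1 e2 e3 e dist by (auto simp: doubleton_eq_iff)
  have ends_G2: "ends G2 e1 = {u, v1}" "ends G2 e2 = {u, v2}" "ends G2 e3 = {u, v3}"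
      "ends G2 f = {v1, v3}"
    using G2 e1 e2 e3 f_neq not_e by auto
  have finite2: "finite_graph G2"
    using finite V dist by (auto simp: finite_graph_def G2)

  have "{g \<in> edges G1. ends G1 g \<inter> ends G1 e = {} \<and> u \<in> ends G1 g}
      = {g \<in> {g \<in> edges G1. u \<in> ends G1 g}. ends G1 g \<inter> ends G1 e = {}}"
    by auto
  also have "\<dots> = {e3}"
    unfolding at_u using e1 e2 e3 e dist by auto
  finally have Z1: "partition_function G1 = partition_function (delete_edge e G1)
      + a * d * partition_function (delete_verts ?S G1)"
    using partition_function_forced_edge[OF finite e(1)] e e3 by (simp add: insert_commute)

  have at_u2: "{g \<in> edges G2. u \<in> ends G2 g} = {e1, e2, e3}"
  proof -
    have "{g \<in> edges G2. u \<in> ends G2 g} = {g \<in> edges G1. u \<in> ends G1 g} - {e}"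
      using dist e f by (auto simp: G2)
    then show ?thesis
      using at_u not_e by auto
  qed
  have "{g \<in> edges G2. ends G2 g \<inter> ends G2 f = {} \<and> u \<in> ends G2 g}
      = {g \<in> {g \<in> edges G2. u \<in> ends G2 g}. ends G2 g \<inter> ends G2 f = {}}"
    by auto
  also have "\<dots> = {e2}"
    unfolding at_u2 using ends_G2 dist by auto
  finally have "partition_function G2 = partition_function (delete_edge f G2)
      + wt G2 f * wt G2 e2 * partition_function (delete_verts (ends G2 f \<union> ends G2 e2) G2)"
    by (rule partition_function_forced_edge[OF finite2, rotated]) (simp add: G2)
  moreover have "wt G2 f = a * d / b" "wt G2 e2 = b"
    using e2 f_neq not_e by (auto simp: G2)
  moreover have "ends G2 f \<union> ends G2 e2 = ?S"
    using ends_G2 by auto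
  moreover have "b > 0"
    using positive e2 by (auto simp: positive_weights_def)
  ultimately have Z2: "partition_function G2 = partition_function (delete_edge f G2)
      + a * d * partition_function (delete_verts ?S G2)"
    by simp

  have "partition_function (delete_edge f G2) = partition_function (delete_edge e G1)"
    by (rule partition_function_cong) (use f in \<open>auto simp: G2\<close>)
  moreover have "partition_function (delete_verts ?S G2) = partition_function (delete_verts ?S G1)"
    by (rule partition_function_cong) (use e f in \<open>auto simp: G2 split: if_splits\<close>)
  ultimately show ?thesis
    using Z1 Z2 by simp
qed

end
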